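(* Let $p\ge 3$ be an integer, let $\Gamma_p$ be the Hecke group and let $g\in\Gamma_p$. Then the following are equivalent. (1) $g$ is reciprocal in $\Gamma_p$. (2) If $p$ is odd: $g$ is either an involution or conjugate in $\Gamma_p$ to a hyperbolic element $h$ whose fixed-point ratio $\theta_h$ is $0$; equivalently, the lifts of $h$ in $\mathrm{SL}(2,\mathbb{R})$ are symmetric matrices. If $p$ is even: $g$ is either an involution or conjugate in $\Gamma_p$ to a hyperbolic element $h$ whose fixed-point ratio $\theta_h$ is either $0$, $1$, or $\cos(\pi/p)$.
   Context: For an integer $p\ge 3$ the Hecke group $\Gamma_p\subset \mathrm{PSL}(2,\mathbb{R})$ is the group generated by the maps $\iota: z\mapsto -1/z$ and $\alpha_p: z\mapsto z+2\cos(\pi/p)$. An element $g$ of a group $G$ is reciprocal if there exists $h\in G$ with $g^{-1}=hgh^{-1}$. An involution is an element $h$ with $h^2=1$. An element of $\mathrm{PSL}(2,\mathbb{R})$ is hyperbolic if a lift to $\mathrm{SL}(2,\mathbb{R})$ has $|\mathrm{trace}|>2$. Fixed-point ratio: for a hyperbolic $A\in \mathrm{PSL}(2,\mathbb{R})$ represented by $\begin{bmatrix} a& b\\ c& d\end{bmatrix}\in\mathrm{SL}(2,\mathbb{R})$, set $\theta_A=\frac{b-c}{a-d}$ if $a\ne d$; $\theta_A=\infty$ if $a=d$ and $b\neq c$; $\theta_A=1$ if $a=d$ and $b=c$. *)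

theory Defs
  imports "HOL-Analysis.Analysis" "HOL-Algebra.Elementary_Groups"
begin

definition SL2R :: "(real^2^2) monoid" where
  "SL2R = \<lparr>carrier = {A. det A = 1}, mult = (**), one = mat 1\<rparr>"

text \<open>An element of \<open>PSL2R\<close> is a coset \<open>{A, -A}\<close>; its members are the lifts of that
  element to \<open>SL2R\<close>. The matrix with rows \<open>(a, b)\<close> and \<open>(c, d)\<close> corresponds to the map
  \<open>z \<mapsto> (a * z + b) / (c * z + d)\<close>, and the coset identifies the two matrices that induce
  the same map.\<close>

definition pm1 :: "(real^2^2) set" where
  "pm1 = {mat 1, - mat 1}"

definition PSL2R :: "(real^2^2) set monoid" where
  "PSL2R = SL2R Mod pm1"

definition psl :: "real^2^2 \<Rightarrow> (real^2^2) set" where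
  "psl A = pm1 #>\<^bsub>SL2R\<^esub> A"

definition iota :: "(real^2^2) set" where
  "iota = psl (vector [vector [0, -1], vector [1, 0]])"

definition alpha :: "nat \<Rightarrow> (real^2^2) set" where
  "alpha p = psl (vector [vector [1, 2 * cos (pi / real p)], vector [0, 1]])"

definition Hecke_group :: "nat \<Rightarrow> (real^2^2) set monoid" where
  "Hecke_group p = subgroup_generated PSL2R {iota, alpha p}"

definition reciprocal :: "('a, 'b) monoid_scheme \<Rightarrow> 'a \<Rightarrow> bool" where
  "reciprocal G g \<longleftrightarrow> g \<in> carrier G \<and>
     (\<exists>h\<in>carrier G. inv\<^bsub>G\<^esub> g = h \<otimes>\<^bsub>G\<^esub> g \<otimes>\<^bsub>G\<^esub> inv\<^bsub>G\<^esub> h)"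

text \<open>The identity counts as an involution.\<close>

definition involution :: "('a, 'b) monoid_scheme \<Rightarrow> 'a \<Rightarrow> bool" where
  "involution G h \<longleftrightarrow> h \<in> carrier G \<and> h [^]\<^bsub>G\<^esub> (2::nat) = \<one>\<^bsub>G\<^esub>"

definition conjugate_in :: "('a, 'b) monoid_scheme \<Rightarrow> 'a \<Rightarrow> 'a \<Rightarrow> bool" where
  "conjugate_in G g h \<longleftrightarrow> g \<in> carrier G \<and> h \<in> carrier G \<and>
     (\<exists>x\<in>carrier G. h = x \<otimes>\<^bsub>G\<^esub> g \<otimes>\<^bsub>G\<^esub> inv\<^bsub>G\<^esub> x)"

definition hyperbolic :: "(real^2^2) set \<Rightarrow> bool" where
  "hyperbolic X \<longleftrightarrow> X \<in> carrier PSL2R \<and> (\<exists>A\<in>X. \<bar>trace A\<bar> > 2)"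

definition fixed_point_ratio_mat :: "real^2^2 \<Rightarrow> ereal" where
  "fixed_point_ratio_mat A =
     (if A$1$1 \<noteq> A$2$2 then ereal ((A$1$2 - A$2$1) / (A$1$1 - A$2$2))
      else if A$1$2 \<noteq> A$2$1 then \<infinity>
      else 1)"

text \<open>The value does not depend on the chosen lift; see \<open>fixed_point_ratio_lift\<close> below.\<close>

definition fixed_point_ratio :: "(real^2^2) set \<Rightarrow> ereal" where
  "fixed_point_ratio X = fixed_point_ratio_mat (SOME A. A \<in> X)"

lemma group_SL2R: "group SL2R"
proof (rule groupI)
  fix A assume "A \<in> carrier SL2R"
  then have "det A = 1" by (simp add: SL2R_def)
  then obtain B where B: "B ** A = mat 1"
    by (metis invertible_det_nz invertible_def zero_neq_one)
  with \<open>det A = 1\<close> have "det B = 1" by (metis det_I det_mul mult.right_neutral)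
  with B show "\<exists>B\<in>carrier SL2R. B \<otimes>\<^bsub>SL2R\<^esub> A = \<one>\<^bsub>SL2R\<^esub>"
    by (auto simp: SL2R_def)
qed (auto simp: SL2R_def det_mul matrix_mul_assoc)

lemma neg_one_mult:
  fixes A :: "real^2^2"
  shows "(- mat 1) ** A = - A" "A ** (- mat 1) = - A"
  by (simp_all add: vec_eq_iff matrix_matrix_mult_def mat_def sum_2 forall_2)

lemma det_neg_one: "det (- mat 1 :: real^2^2) = 1"
  by (simp add: det_2 mat_def)

lemma psl_eq: "psl A = {A, - A}"
  by (auto simp: psl_def pm1_def r_coset_def SL2R_def neg_one_mult)

lemma normal_pm1: "pm1 \<lhd> SL2R"
proof -
  have inv: "inv\<^bsub>SL2R\<^esub> (- mat 1) = - mat 1"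
    by (rule group.inv_equality[OF group_SL2R]) (auto simp: SL2R_def neg_one_mult det_neg_one)
  have "subgroup pm1 SL2R"
    using inv group.is_monoid[OF group_SL2R]
    by (intro group.subgroupI[OF group_SL2R])
      (auto simp: pm1_def SL2R_def neg_one_mult det_neg_one
        monoid.inv_one[of SL2R, unfolded SL2R_def, simplified])
  moreover have "pm1 #>\<^bsub>SL2R\<^esub> A = A <#\<^bsub>SL2R\<^esub> pm1" for A
    by (auto simp: pm1_def r_coset_def l_coset_def SL2R_def neg_one_mult)
  ultimately show ?thesis
    by (intro group.normalI[OF group_SL2R]) auto
qed

lemma group_PSL2R: "group PSL2R"
  unfolding PSL2R_def by (rule normal.factorgroup_is_group[OF normal_pm1])

lemma carrier_PSL2R: "carrier PSL2R = psl ` {A. det A = 1}"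
  by (auto simp: PSL2R_def carrier_FactGroup psl_def SL2R_def)

lemma generators_in_PSL2R: "iota \<in> carrier PSL2R" "alpha p \<in> carrier PSL2R"
  by (auto simp: carrier_PSL2R iota_def alpha_def det_2)

lemma carrier_Hecke_group: "carrier (Hecke_group p) = generate PSL2R {iota, alpha p}"
  by (simp add: Hecke_group_def carrier_subgroup_generated generators_in_PSL2R)

lemma group_Hecke_group: "group (Hecke_group p)"
  unfolding Hecke_group_def by (rule group.group_subgroup_generated[OF group_PSL2R])

lemma fixed_point_ratio_mat_minus: "fixed_point_ratio_mat (- A) = fixed_point_ratio_mat A"
proof -
  have "(- A$1$2 + A$2$1) / (- A$1$1 + A$2$2) = (A$1$2 - A$2$1) / (A$1$1 - A$2$2)"
    if "A$1$1 \<noteq> A$2$2"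
    using that by (simp add: divide_simps) (simp add: algebra_simps)
  then show ?thesis by (simp add: fixed_point_ratio_mat_def)
qed

lemma fixed_point_ratio_lift:
  assumes "X \<in> carrier PSL2R" "A \<in> X"
  shows "fixed_point_ratio X = fixed_point_ratio_mat A"
proof -
  have "\<exists>B. X = {B, - B}"
    using assms(1) by (auto simp: carrier_PSL2R psl_eq)
  moreover have "(SOME B. B \<in> X) \<in> X"
    using assms(2) by (rule someI)
  ultimately have "(SOME B. B \<in> X) = A \<or> (SOME B. B \<in> X) = - A"
    using assms(2) by auto
  then show ?thesis
    unfolding fixed_point_ratio_def by (auto simp: fixed_point_ratio_mat_minus)
qed

end

theory Submission
  imports Defs
begin

text \<open>
  Work with lifts to \<open>SL(2, \<real>)\<close>, where \<open>A\<^sup>-\<^sup>1\<close> is the adjugate of \<open>A\<close>.  If \<open>H\<close> conjugates \<open>A\<close> to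
  \<open>\<plusminus>A\<^sup>-\<^sup>1\<close> and \<open>A\<close> is not an involution of \<open>PSL(2, \<real>)\<close>, then elementary algebra
  (\<open>reversed_cases\<close>) shows that \<open>A\<close> is hyperbolic, that \<open>H\<close> is a half turn, \<open>trace H = 0\<close>, and that
  the axis of \<open>A\<close> passes through the fixed point of \<open>H\<close>, which reads \<open>trace (H A) = 0\<close>.  Conversely
  a half turn reverses every \<open>A\<close> whose axis passes through its fixed point
  (\<open>reversed_by_half_turn\<close>).  So the question is which half turns the Hecke group contains.

  The Hecke group is generated by the half turn \<open>S : z \<mapsto> -1/z\<close> and the rotation
  \<open>R 1 : z \<mapsto> 2 cos (\<pi>/p) - 1/z\<close> of order \<open>p\<close>.  Collecting the letters \<open>V k = - (R 1)\<^sup>k S\<close> brings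
  every element into the form \<open>\<plusminus>S\<^sup>e V k\<^sub>1 \<dots> V k\<^sub>n R k\<close> (\<open>lifts_normal_form\<close>), and cyclic
  permutation conjugates it to \<open>\<plusminus>S\<close>, to a power of \<open>R 1\<close> or to a word in the letters, up to sign.
  The letters with \<open>1 \<le> k < p\<close> have nonnegative entries and positive diagonal, so words have positive
  trace.  Hence each half turn is conjugate to \<open>S\<close> or, for even \<open>p\<close>, to the middle power \<open>R (p / 2)\<close>
  (\<open>trace_zero_conj_half_turn\<close>).  The condition \<open>trace (S B) = 0\<close> says that \<open>B\<close> is symmetric.
  For \<open>R (p / 2)\<close>, conjugated by \<open>S\<close>, it becomes
  \<open>b - c = cos (\<pi>/p) (a - d)\<close> for the entries \<open>a, b, c, d\<close> of \<open>B\<close>.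

  These two conditions still have to be compared with the values of the fixed-point ratio, and the
  comparison needs the discreteness of the group at the boundary points \<open>\<plusminus>1\<close>.  A hyperbolic
  symmetric \<open>B\<close> with \<open>a = d\<close> has ratio \<open>1\<close> rather than \<open>0\<close>, and its fixed points are \<open>\<plusminus>1\<close>.  For odd
  \<open>p\<close> there is none, because \<open>1\<close> lies in the orbit of \<open>\<infinity>\<close> and the stabilizer of \<open>\<infinity>\<close> consists of
  parabolic elements and the identity (\<open>not_hyperbolic_fixing_one\<close>).  For even \<open>p\<close> ratio \<open>1\<close> means
  that \<open>B\<close> fixes \<open>-1\<close>.  The matrices of the group that fix \<open>1\<close> are, up to sign, powers of \<open>V (p / 2)\<close>, whose
  fixed points are \<open>\<plusminus>1\<close>, and hence they are symmetric with \<open>a = d\<close> (\<open>fixing_one_even\<close>); conjugation by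
  \<open>S\<close> transports this to \<open>-1\<close>, so that ratio \<open>1\<close> again forces \<open>B\<close> to be symmetric.
\<close>

section \<open>Two by two matrices\<close>

definition mat2 :: "real \<Rightarrow> real \<Rightarrow> real \<Rightarrow> real \<Rightarrow> real^2^2" where
  "mat2 a b c d = vector [vector [a, b], vector [c, d]]"

lemma mat2_nth [simp]:
  "mat2 a b c d $ 1 $ 1 = a" "mat2 a b c d $ 1 $ 2 = b"
  "mat2 a b c d $ 2 $ 1 = c" "mat2 a b c d $ 2 $ 2 = d"
  by (simp_all add: mat2_def)

lemma mat2_collapse: "mat2 (A $ 1 $ 1) (A $ 1 $ 2) (A $ 2 $ 1) (A $ 2 $ 2) = A"
  by (simp add: vec_eq_iff forall_2)

lemma mat2_cases [cases type]: obtains a b c d where "A = mat2 a b c d"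
  by (metis mat2_collapse)

lemma mat2_eq_iff [simp]:
  "mat2 a b c d = mat2 a' b' c' d' \<longleftrightarrow> a = a' \<and> b = b' \<and> c = c' \<and> d = d'"
  by (metis mat2_nth)

lemma mat2_mult [simp]:
  "mat2 a b c d ** mat2 a' b' c' d' =
    mat2 (a * a' + b * c') (a * b' + b * d') (c * a' + d * c') (c * b' + d * d')"
  by (simp add: vec_eq_iff forall_2 matrix_matrix_mult_def sum_2)

lemma mat2_minus [simp]: "- mat2 a b c d = mat2 (- a) (- b) (- c) (- d)"
  by (simp add: vec_eq_iff forall_2)

lemma mat_1_mat2: "mat 1 = mat2 1 0 0 1"
  by (simp add: vec_eq_iff forall_2 mat_def)

lemma det_mat2 [simp]: "det (mat2 a b c d) = a * d - b * c"
  by (simp add: det_2)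

lemma trace_mat2 [simp]: "trace (mat2 a b c d) = a + d"
  by (simp add: trace_def sum_2)

lemma transpose_mat2 [simp]: "transpose (mat2 a b c d) = mat2 a c b d"
  by (simp add: vec_eq_iff forall_2 transpose_def)

lemma trace_minus: "trace (- A) = - trace (A :: real^2^2)"
  by (cases A) simp

lemma minus_matrix_mult:
  fixes A B :: "real^2^2"
  shows "(- A) ** B = - (A ** B)" "A ** (- B) = - (A ** B)"
  by (cases A; cases B; simp)+

lemma det_minus: "det (- A) = det (A :: real^2^2)"
  by (cases A) simp

definition adjugate :: "real^2^2 \<Rightarrow> real^2^2" where
  "adjugate A = mat2 (A $ 2 $ 2) (- A $ 1 $ 2) (- A $ 2 $ 1) (A $ 1 $ 1)"

lemma adjugate_mat2 [simp]: "adjugate (mat2 a b c d) = mat2 d (- b) (- c) a"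
  by (simp add: adjugate_def)

lemma adjugate_mat_1: "adjugate (mat 1) = mat 1"
  by (simp add: mat_1_mat2)

lemma det_adjugate [simp]: "det (adjugate A) = det A"
  by (cases A) simp

lemma adjugate_inverse:
  assumes "det A = 1"
  shows "adjugate A ** A = mat 1" "A ** adjugate A = mat 1"
  using assms by (cases A; simp add: mat_1_mat2 algebra_simps)+

lemma adjugate_mult: "adjugate (A ** B) = adjugate B ** adjugate A"
  by (cases A; cases B; simp add: algebra_simps)

lemma adjugate_minus: "adjugate (- A) = - adjugate A"
  by (cases A) simp

text \<open>With the sign minus, invariance of the trace under conjugation gives
  \<open>trace A = - trace A\<close>.  With the sign plus, comparing the entries of \<open>H ** A\<close> and
  \<open>adjugate A ** H\<close> shows that \<open>trace H\<close> annihilates the traceless part of \<open>A\<close>, so that \<open>H\<close> is a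
  half turn unless \<open>A\<close> is scalar.  The one remaining linear relation between the entries is
  \<open>trace (H ** A) = 0\<close>; it makes a positive multiple of the discriminant \<open>(trace A)\<^sup>2 - 4\<close> a sum of two
  squares that vanish together only for scalar \<open>A\<close>.\<close>

lemma reversed_cases:
  assumes detA: "det A = 1" and detH: "det H = 1"
    and rev: "H ** A ** adjugate H = adjugate A \<or> H ** A ** adjugate H = - adjugate A"
  obtains "A = mat 1 \<or> A = - mat 1" | "trace A = 0"
  | "trace H = 0" "trace (H ** A) = 0" "\<bar>trace A\<bar> > 2"
proof -
  obtain a b c d where A: "A = mat2 a b c d" by (cases A)
  obtain x y z w where H: "H = mat2 x y z w" by (cases H)
  have "H ** A ** adjugate H ** H = H ** A"
    by (metis adjugate_inverse(1) detH matrix_mul_assoc matrix_mul_rid)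
  with rev have rev': "H ** A = adjugate A ** H \<or> H ** A = - (adjugate A ** H)"
    by (metis minus_matrix_mult(1))
  have dA: "a * d - b * c = 1" and dH: "x * w - y * z = 1"
    using detA detH by (simp_all add: A H)
  show ?thesis
  proof (cases "H ** A = adjugate A ** H")
    case False
    with rev have "H ** A ** adjugate H = - adjugate A"
      by (metis adjugate_inverse(1) detH matrix_mul_assoc matrix_mul_rid)
    then have "trace (H ** A ** adjugate H) = - trace A"
      by (simp add: A)
    moreover have "trace (H ** A ** adjugate H) = (x * w - y * z) * trace A"
      by (simp add: A H algebra_simps)
    ultimately have "trace A = 0" using dH by simp
    then show ?thesis using that by blast
  next
    case True
    then have e: "x * (a - d) + y * c + z * b = 0" "(x + w) * b = 0" "(x + w) * c = 0"
      "(x + w) * (a - d) = 0"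
      by (simp_all add: A H algebra_simps)
    have scalar: ?thesis if "b = 0" "c = 0" "a = d"
    proof -
      have "a * a = 1" using dA that by simp
      then have "a = 1 \<or> a = -1" by (simp add: square_eq_1_iff)
      then have "A = mat 1 \<or> A = - mat 1" using that by (auto simp: A mat_1_mat2)
      then show ?thesis using \<open>A = mat 1 \<or> A = - mat 1 \<Longrightarrow> thesis\<close> by blast
    qed
    show ?thesis
    proof (cases "x + w = 0 \<and> \<not> (b = 0 \<and> c = 0 \<and> a = d)")
      case False
      then show ?thesis using e scalar by auto
    next
      case True
      then have w: "w = - x" by simp
      have yz: "- (y * z) = x\<^sup>2 + 1" using dH by (simp add: w power2_eq_square)
      have zb: "z * b + y * c = - (x * (a - d))" using e(1) by simp
      \<comment> \<open>Multiplying by \<open>x\<^sup>2 + 1 = - y z\<close> turns \<open>b c\<close> into the product of the two terms whose sum is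
        known from \<open>zb\<close>.\<close>
      have "(x\<^sup>2 + 1) * ((a - d)\<^sup>2 + 4 * (b * c)) = (x\<^sup>2 + 1) * (a - d)\<^sup>2 - 4 * (y * c) * (z * b)"
        unfolding yz[symmetric] by algebra
      also have "\<dots> = (a - d)\<^sup>2 + (z * b + y * c)\<^sup>2 - 4 * (y * c) * (z * b)"
        unfolding zb by algebra
      also have "\<dots> = (a - d)\<^sup>2 + (z * b - y * c)\<^sup>2" by algebra
      finally have sq: "(x\<^sup>2 + 1) * ((a - d)\<^sup>2 + 4 * (b * c)) = (a - d)\<^sup>2 + (z * b - y * c)\<^sup>2" .
      have "a - d \<noteq> 0 \<or> z * b - y * c \<noteq> 0"
      proof (rule ccontr)
        assume "\<not> ?thesis"
        then have 0: "a = d" "z * b = y * c" by auto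
        with zb have "z * b = 0" "y * c = 0" by auto
        moreover have "y \<noteq> 0" "z \<noteq> 0"
          using yz by (auto simp: add_nonneg_eq_0_iff)
        ultimately show False using True 0 by auto
      qed
      then have "(a - d)\<^sup>2 + (z * b - y * c)\<^sup>2 > 0"
        by (metis sum_power2_gt_zero_iff)
      then have "(a - d)\<^sup>2 + 4 * (b * c) > 0"
        unfolding sq[symmetric] by (rule zero_less_mult_pos) (simp add: add_nonneg_pos)
      moreover have "(a - d)\<^sup>2 + 4 * (b * c) = (a + d)\<^sup>2 - 4 * (a * d - b * c)" by algebra
      ultimately have "(a + d)\<^sup>2 > 2\<^sup>2" using dA by simp
      then have "\<bar>a + d\<bar> > 2" by (metis abs_le_square_iff abs_numeral linorder_not_le)
      moreover have "trace H = 0" "trace (H ** A) = 0"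
        using e(1) by (auto simp: A H w algebra_simps)
      ultimately show ?thesis using that(3) by (simp add: A)
    qed
  qed
qed

lemma reversed_by_half_turn:
  assumes "det H = 1" "trace H = 0" "trace (H ** A) = 0"
  shows "H ** A ** adjugate H = adjugate A"
proof -
  obtain a b c d where A: "A = mat2 a b c d" by (cases A)
  obtain x y z w where H: "H = mat2 x y z w" by (cases H)
  have w: "w = - x" using assms(2) by (simp add: H)
  have "x * (a - d) + y * c + z * b = 0" using assms(3) by (simp add: A H w algebra_simps)
  then have "H ** A = adjugate A ** H" by (simp add: A H w algebra_simps)
  then show ?thesis
    by (metis adjugate_inverse(2) assms(1) matrix_mul_assoc matrix_mul_rid)
qed

section \<open>Cosets and their lifts\<close>

lemma psl_mult:
  assumes "det A = 1" "det B = 1"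
  shows "psl A \<otimes>\<^bsub>PSL2R\<^esub> psl B = psl (A ** B)"
  using normal.rcos_sum[OF normal_pm1, of A B] assms
  by (simp add: psl_def PSL2R_def FactGroup_def SL2R_def)

lemma psl_one: "\<one>\<^bsub>PSL2R\<^esub> = psl (mat 1)"
  by (simp add: PSL2R_def FactGroup_def psl_eq pm1_def)

lemma psl_carrier: "det A = 1 \<Longrightarrow> psl A \<in> carrier PSL2R"
  by (auto simp: carrier_PSL2R)

lemma psl_inv:
  assumes "det A = 1"
  shows "inv\<^bsub>PSL2R\<^esub> psl A = psl (adjugate A)"
  using assms
  by (intro group.inv_equality[OF group_PSL2R])
    (simp_all add: psl_mult psl_one adjugate_inverse psl_carrier)

lemma psl_eq_iff: "psl A = psl B \<longleftrightarrow> A = B \<or> A = - B"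
  by (auto simp: psl_eq doubleton_eq_iff)

section \<open>Half turn and rotation of order p\<close>

locale hecke =
  fixes p :: nat
  assumes p_ge: "p \<ge> 3"
begin

definition t :: real where "t = pi / real p"

lemma p_t: "real p * t = pi"
  using p_ge by (simp add: t_def)

lemma t_pos: "t > 0"
  using p_ge by (simp add: t_def)

lemma multiple_less_pi: "k < p \<Longrightarrow> real k * t < pi"
  using mult_strict_right_mono[of "real k" "real p" t] t_pos p_t by simp

lemma sin_t_pos: "sin t > 0"
  using multiple_less_pi[of 1] p_ge t_pos by (intro sin_gt_zero) auto

lemma sin_multiple_pos: "0 < k \<Longrightarrow> k < p \<Longrightarrow> sin (real k * t) > 0"
  using multiple_less_pi[of k] t_pos by (intro sin_gt_zero) auto

lemma sin_multiple_nonneg: "k \<le> p \<Longrightarrow> sin (real k * t) \<ge> 0"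
  using sin_multiple_pos[of k] p_t by (cases "k = 0 \<or> k = p") force+

text \<open>The one-parameter group of rotations about \<open>exp (\<i> t)\<close>, the fixed point of
  \<open>z \<mapsto> 2 cos t - 1/z\<close> in the upper half plane.  The parameter is half of the angle of rotation, so
  \<open>turn pi = - mat 1\<close>; the matrix \<open>turn t\<close> induces the map just named.\<close>

definition turn :: "real \<Rightarrow> real^2^2" where
  "turn x = mat2 (sin (x + t) / sin t) (- sin x / sin t) (sin x / sin t) (- sin (x - t) / sin t)"

text \<open>Shifting \<open>x\<close> or \<open>y\<close> by \<open>t\<close> in this identity yields the four entries of \<open>turn_add\<close>.\<close>

lemma sin_product: "sin (x + t) * sin (y + t) - sin x * sin y = sin t * sin (x + y + t)"
proof -
  have "sin (x + t) * sin (y + t) - sin x * sin y - sin t * sin (x + y + t)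
      = sin x * sin y * ((sin t)\<^sup>2 + (cos t)\<^sup>2 - 1)"
    unfolding sin_add cos_add by algebra
  then show ?thesis by simp
qed

lemma turn_add: "turn x ** turn y = turn (x + y)"
  using sin_product[of x y] sin_product[of x "y - t"] sin_product[of "x - t" y]
    sin_product[of "x - t" "y - t"] sin_t_pos
  by (simp add: turn_def field_simps)

lemma turn_0: "turn 0 = mat 1"
  using sin_t_pos by (simp add: turn_def mat_1_mat2)

lemma turn_pi: "turn (x + pi) = - turn x"
proof -
  have "x + pi + t = (x + t) + pi" "x + pi - t = (x - t) + pi" by simp_all
  then show ?thesis by (simp only: turn_def sin_periodic_pi) simp
qed

lemma det_turn: "det (turn x) = 1"
proof -
  have "sin x * sin x - sin (x + t) * sin (x - t) = sin t * sin t"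
    using sin_product[of x "- x"] sin_minus[of "x - t"] by simp
  then show ?thesis using sin_t_pos by (simp add: turn_def field_simps)
qed

definition S :: "real^2^2" where "S = mat2 0 (-1) 1 0"

definition R :: "nat \<Rightarrow> real^2^2" where "R k = turn (real k * t)"

text \<open>Since \<open>S\<^sup>-\<^sup>1 = - S\<close>, this is \<open>R k ** S\<^sup>-\<^sup>1\<close>; with this choice of the sign the entries are
  nonnegative for \<open>1 \<le> k < p\<close>, and \<open>V 1\<close> is a lift of the translation \<open>alpha p\<close>.\<close>

definition V :: "nat \<Rightarrow> real^2^2" where "V k = - (R k ** S)"

lemma S_S: "S ** S = - mat 1"
  by (simp add: S_def mat_1_mat2)

lemma det_S: "det S = 1"
  by (simp add: S_def)

lemma adjugate_S: "adjugate S = - S"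
  by (simp add: S_def)

lemma R_0: "R 0 = mat 1"
  by (simp add: R_def turn_0)

lemma R_add: "R j ** R k = R (j + k)"
  by (simp add: R_def turn_add algebra_simps)

lemma R_add_p: "R (k + p) = - R k"
  using turn_pi[of "real k * t"] by (simp add: R_def algebra_simps p_t)

lemma det_R: "det (R k) = 1"
  by (simp add: R_def det_turn)

lemma V_mat2:
  "V k = mat2 (sin (real k * t) / sin t) (sin (real k * t + t) / sin t)
              (sin (real k * t - t) / sin t) (sin (real k * t) / sin t)"
  by (simp add: V_def R_def S_def turn_def)

lemma V_S: "V k ** S = R k"
  by (simp add: V_def minus_matrix_mult matrix_mul_assoc[symmetric] S_S)

lemma R_S: "R k ** S = - V k"
  by (simp add: V_def)

lemma det_V: "det (V k) = 1"
  by (simp add: V_def det_minus det_mul det_R det_S)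

lemma V_1: "V 1 = mat2 1 (2 * cos t) 0 1"
  using sin_t_pos sin_double[of t] by (simp add: V_mat2)

section \<open>Normal forms of the elements of the Hecke group\<close>

primrec word :: "nat list \<Rightarrow> real^2^2" where
  "word [] = mat 1"
| "word (k # ks) = V k ** word ks"

lemma word_append: "word (ks @ ls) = word ks ** word ls"
  by (induction ks) (simp_all add: matrix_mul_assoc)

abbreviation letters :: "nat list \<Rightarrow> bool" where
  "letters ks \<equiv> set ks \<subseteq> {1..<p}"

definition lifts :: "(real^2^2) set" where
  "lifts = {A. det A = 1 \<and> psl A \<in> carrier (Hecke_group p)}"

lemma lifts_det: "A \<in> lifts \<Longrightarrow> det A = 1"
  by (simp add: lifts_def)

lemma lifts_mult: "A \<in> lifts \<Longrightarrow> B \<in> lifts \<Longrightarrow> A ** B \<in> lifts"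
  by (auto simp: lifts_def det_mul carrier_Hecke_group psl_mult[symmetric] intro: generate.eng)

lemma lifts_minus: "A \<in> lifts \<Longrightarrow> - A \<in> lifts"
  by (simp add: lifts_def det_minus psl_eq insert_commute)

lemma lifts_adjugate:
  assumes "A \<in> lifts"
  shows "adjugate A \<in> lifts"
  using assms group.generate_m_inv_closed[OF group_PSL2R, of "{iota, alpha p}" "psl A"]
  by (simp add: lifts_def carrier_Hecke_group psl_inv generators_in_PSL2R)

lemma lifts_S: "S \<in> lifts"
  using generate.incl[of iota "{iota, alpha p}" PSL2R]
  by (simp add: lifts_def carrier_Hecke_group iota_def S_def det_S mat2_def[symmetric])

lemma lifts_V_1: "V 1 \<in> lifts"
  using generate.incl[of "alpha p" "{iota, alpha p}" PSL2R]
  unfolding V_1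
  by (simp add: lifts_def carrier_Hecke_group alpha_def mat2_def[symmetric] t_def)

lemma lifts_R: "R k \<in> lifts"
proof (induction k)
  case 0
  then show ?case
    by (simp add: R_0 lifts_def psl_one[symmetric] group.is_monoid carrier_Hecke_group generate.one)
next
  case (Suc k)
  have "R 1 \<in> lifts" by (metis V_S lifts_S lifts_V_1 lifts_mult)
  from lifts_mult[OF Suc this] show ?case by (simp add: R_add)
qed

lemma lifts_V: "V k \<in> lifts"
  by (simp add: V_def lifts_minus lifts_mult lifts_R lifts_S)

lemma lifts_word: "word ks \<in> lifts"
  using lifts_R[of 0] by (induction ks) (auto simp: R_0 lifts_mult lifts_V)

text \<open>Closing the set under \<open>A \<mapsto> - A\<close> lets arguments about elements of the group, which
  determine a matrix up to sign, ignore the sign.\<close>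

inductive_set normal_forms :: "(real^2^2) set" where
  plain: "letters ks \<Longrightarrow> k < p \<Longrightarrow> word ks ** R k \<in> normal_forms"
| flipped: "letters ks \<Longrightarrow> k < p \<Longrightarrow> S ** (word ks ** R k) \<in> normal_forms"
| minus: "A \<in> normal_forms \<Longrightarrow> - A \<in> normal_forms"

lemma normal_forms_R:
  assumes "A \<in> normal_forms" "j < p"
  shows "A ** R j \<in> normal_forms"
proof -
  have *: "\<exists>i<p. R k ** R j = R i \<or> R k ** R j = - R i" if "k < p" for k
  proof (cases "k + j < p")
    case True
    then show ?thesis by (auto simp: R_add)
  next
    case False
    then show ?thesis using R_add_p[of "k + j - p"] that \<open>j < p\<close>
      by (intro exI[of _ "k + j - p"]) (auto simp: R_add)
  qed
  from assms(1) show ?thesis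
  proof induction
    case (plain ks k)
    then show ?case using *[of k]
      by (metis matrix_mul_assoc minus_matrix_mult(2) normal_forms.plain normal_forms.minus)
  next
    case (flipped ks k)
    then show ?case using *[of k]
      by (metis matrix_mul_assoc minus_matrix_mult(2) normal_forms.flipped normal_forms.minus)
  next
    case (minus A)
    then show ?case by (simp add: minus_matrix_mult normal_forms.minus)
  qed
qed

text \<open>If \<open>k > 0\<close>, then \<open>R k ** S\<close> is up to sign the new last letter \<open>V k\<close>; if \<open>k = 0\<close>,
  then \<open>S\<close>, unless the word is empty, cancels against the \<open>S\<close> in the last letter \<open>V j\<close> and releases \<open>R j\<close>.\<close>

lemma word_R_S_cases:
  assumes "letters ks" "k < p"
  obtains "word ks ** R k = mat 1"
  | ls j where "letters ls" "j < p"
      "word ks ** R k ** S = word ls ** R j \<or> word ks ** R k ** S = - (word ls ** R j)"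
proof (cases "k = 0")
  case False
  have "word ks ** R k ** S = - (word (ks @ [k]) ** R 0)"
    by (simp add: word_append R_0 matrix_mul_assoc[symmetric] R_S minus_matrix_mult)
  then show ?thesis using that(2)[of "ks @ [k]" 0] assms False by auto
next
  case True
  show ?thesis
  proof (cases ks rule: rev_cases)
    case Nil
    then show ?thesis using that(1) True by (simp add: R_0)
  next
    case (snoc ls j)
    have "word ks ** R k ** S = word ls ** R j"
      by (simp add: snoc True R_0 word_append matrix_mul_assoc[symmetric] V_S)
    then show ?thesis using that(2)[of ls j] assms snoc by auto
  qed
qed

lemma normal_forms_S:
  assumes "A \<in> normal_forms"
  shows "A ** S \<in> normal_forms"
  using assms
proof induction
  case (plain ks k)
  then show ?case
  proof (cases rule: word_R_S_cases)
    case 1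
    then show ?thesis using flipped[of "[]" 0] p_ge by (simp add: R_0)
  next
    case (2 ls j)
    then show ?thesis by (metis normal_forms.minus normal_forms.plain)
  qed
next
  case (flipped ks k)
  then show ?case
  proof (cases rule: word_R_S_cases)
    case 1
    then show ?thesis using minus[OF plain[of "[]" 0]] p_ge
      by (simp add: R_0 S_S)
  next
    case (2 ls j)
    then show ?thesis
      by (metis normal_forms.minus normal_forms.flipped matrix_mul_assoc minus_matrix_mult(2))
  qed
next
  case (minus A)
  then show ?case by (simp add: minus_matrix_mult normal_forms.minus)
qed

text \<open>Both generators and their inverses are, up to sign, products of \<open>S\<close> and powers of \<open>R 1\<close>, and
  right multiplication by these preserves normal forms.\<close>

lemma lifts_normal_form:
  assumes "A \<in> lifts"
  shows "A \<in> normal_forms"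
proof -
  have V1: "B ** V 1 \<in> normal_forms" if "B \<in> normal_forms" for B
    using normal_forms.minus[OF normal_forms_S[OF normal_forms_R[OF that, of 1]]] p_ge
    by (simp add: V_def matrix_mul_assoc minus_matrix_mult)
  have V1': "B ** adjugate (V 1) \<in> normal_forms" if "B \<in> normal_forms" for B
  proof -
    have "adjugate (V 1) = S ** adjugate (R 1)"
      by (simp add: V_def adjugate_minus adjugate_mult adjugate_S minus_matrix_mult)
    also have "adjugate (R 1) = - R (p - 1)"
    proof -
      have "R 1 ** R (p - 1) = - mat 1"
        using R_add_p[of 0] p_ge by (simp add: R_add R_0)
      then have "adjugate (R 1) ** (R 1 ** R (p - 1)) = - adjugate (R 1)"
        by (simp add: minus_matrix_mult)
      then show ?thesis
        by (metis adjugate_inverse(1) det_R matrix_mul_assoc matrix_mul_lid minus_minus)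
    qed
    finally show ?thesis
      using normal_forms.minus[OF normal_forms_R[OF normal_forms_S[OF that], of "p - 1"]] p_ge
      by (simp add: minus_matrix_mult matrix_mul_assoc)
  qed
  have S': "B ** adjugate S \<in> normal_forms" if "B \<in> normal_forms" for B
    using that by (simp add: adjugate_S minus_matrix_mult normal_forms.minus normal_forms_S)
  have iota: "iota = psl S" by (simp add: iota_def S_def mat2_def)
  have alpha: "alpha p = psl (V 1)" unfolding V_1 by (simp add: alpha_def mat2_def t_def)
  \<comment> \<open>Stability of \<open>normal_forms\<close> under right multiplication by \<open>A\<close> passes to products at once, unlike
    membership of \<open>A\<close> in \<open>normal_forms\<close>.\<close>
  have "\<forall>A\<in>X. \<forall>B\<in>normal_forms. B ** A \<in> normal_forms"
    if "X \<in> generate PSL2R {iota, alpha p}" for X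
    using that
  proof induction
    case one
    then show ?case by (auto simp: psl_one psl_eq minus_matrix_mult normal_forms.minus)
  next
    case (incl X)
    then show ?case
      by (auto simp: iota alpha psl_eq minus_matrix_mult normal_forms.minus normal_forms_S V1[simplified])
  next
    case (inv X)
    then have "inv\<^bsub>PSL2R\<^esub> X = psl (adjugate S) \<or> inv\<^bsub>PSL2R\<^esub> X = psl (adjugate (V 1))"
      by (auto simp: iota alpha psl_inv det_S det_V)
    then show ?case
      by (auto simp: psl_eq minus_matrix_mult normal_forms.minus S' V1'[simplified])
  next
    case (eng X Y)
    then have "X \<in> carrier PSL2R" "Y \<in> carrier PSL2R"
      using group.generate_in_carrier[OF group_PSL2R, of "{iota, alpha p}"]
      by (auto simp: generators_in_PSL2R)
    then obtain C D where CD: "X = psl C" "Y = psl D" "det C = 1" "det D = 1"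
      by (auto simp: carrier_PSL2R)
    then have "B ** (C ** D) \<in> normal_forms" if "B \<in> normal_forms" for B
      using eng.IH that by (auto simp: psl_eq matrix_mul_assoc)
    moreover have "X \<otimes>\<^bsub>PSL2R\<^esub> Y = {C ** D, - (C ** D)}"
      using CD by (simp add: psl_mult psl_eq[symmetric])
    ultimately show ?case
      by (auto simp: minus_matrix_mult normal_forms.minus)
  qed
  moreover have "psl A \<in> generate PSL2R {iota, alpha p}"
    using assms by (simp add: lifts_def carrier_Hecke_group)
  moreover have "mat 1 \<in> normal_forms"
    using plain[of "[]" 0] p_ge by (simp add: R_0)
  ultimately show ?thesis by (force simp: psl_eq)
qed

section \<open>Positivity of words\<close>

text \<open>The entries of a letter are \<open>sin ((k - 1) t)\<close>, \<open>sin (k t)\<close> (twice) and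
  \<open>sin ((k + 1) t)\<close>, divided by \<open>sin t\<close>, and \<open>p t = pi\<close>.\<close>

lemma word_pos:
  assumes "letters ks" "word ks = mat2 a b c d"
  shows "a > 0 \<and> b \<ge> 0 \<and> c \<ge> 0 \<and> d > 0"
  using assms
proof (induction ks arbitrary: a b c d)
  case Nil
  then show ?case by (simp add: mat_1_mat2)
next
  case (Cons k ks)
  obtain x y z w where W: "word ks = mat2 x y z w" by (cases "word ks")
  have k: "0 < k" "k < p" using Cons.prems by auto
  have pos: "sin (real k * t) / sin t > 0" "sin (real k * t + t) / sin t \<ge> 0"
    "sin (real k * t - t) / sin t \<ge> 0"
    using sin_multiple_pos[of k] sin_multiple_nonneg[of "k + 1"] sin_multiple_nonneg[of "k - 1"]
      k sin_t_pos by (simp_all add: algebra_simps of_nat_diff)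
  have "x > 0 \<and> y \<ge> 0 \<and> z \<ge> 0 \<and> w > 0" using Cons W by auto
  moreover have "a = sin (real k * t) / sin t * x + sin (real k * t + t) / sin t * z"
    "b = sin (real k * t) / sin t * y + sin (real k * t + t) / sin t * w"
    "c = sin (real k * t - t) / sin t * x + sin (real k * t) / sin t * z"
    "d = sin (real k * t - t) / sin t * y + sin (real k * t) / sin t * w"
    using Cons.prems(2) by (simp_all add: V_mat2 W)
  ultimately show ?case
    using pos by (metis add_nonneg_nonneg add_nonneg_pos add_pos_nonneg less_imp_le
        mult_nonneg_nonneg mult_pos_pos)
qed

lemma trace_word_pos: "letters ks \<Longrightarrow> trace (word ks) > 0"
  using word_pos by (cases "word ks") (fastforce simp: add_pos_pos)

section \<open>Half turns\<close>

definition conj_rel :: "real^2^2 \<Rightarrow> real^2^2 \<Rightarrow> bool" where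
  "conj_rel A B \<longleftrightarrow> (\<exists>X\<in>lifts. B = X ** A ** adjugate X)"

lemma conj_rel_refl: "conj_rel A A"
  unfolding conj_rel_def
  using lifts_R[of 0] by (intro bexI[of _ "mat 1"]) (simp_all add: R_0 adjugate_mat_1)

lemma conj_rel_trans:
  assumes "conj_rel A B" "conj_rel B C"
  shows "conj_rel A C"
  using assms unfolding conj_rel_def
  by (metis adjugate_mult lifts_mult matrix_mul_assoc)

lemma conj_rel_cyclic:
  assumes "A \<in> lifts"
  shows "conj_rel (A ** B) (B ** A)"
proof -
  have "adjugate (adjugate A) = A" by (cases A) simp
  then have "B ** A = adjugate A ** (A ** B) ** adjugate (adjugate A)"
    by (simp add: matrix_mul_assoc adjugate_inverse lifts_det[OF assms])
  then show ?thesis unfolding conj_rel_def using lifts_adjugate[OF assms] by blast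
qed

lemma conj_rel_minus: "conj_rel A B \<Longrightarrow> conj_rel (- A) (- B)"
  by (auto simp: conj_rel_def minus_matrix_mult)

lemma conj_rel_trace:
  assumes "conj_rel A B"
  shows "trace B = trace A"
proof -
  obtain X where X: "X \<in> lifts" "B = X ** A ** adjugate X"
    using assms by (auto simp: conj_rel_def)
  have "trace (X ** A ** adjugate X) = det X * trace A"
    by (cases X; cases A) (simp add: algebra_simps)
  then show ?thesis using X by (simp add: lifts_det)
qed

definition half_turn :: "real^2^2 \<Rightarrow> bool" where
  "half_turn B \<longleftrightarrow> B = S \<or> B = - S \<or> even p \<and> (B = R (p div 2) \<or> B = - R (p div 2))"

lemma half_turn_minus: "half_turn (- B) \<longleftrightarrow> half_turn B"
  by (auto simp: half_turn_def minus_equation_iff[of B])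

lemma trace_zero_R:
  assumes "k < p" "trace (R k) = 0"
  shows "p = 2 * k"
proof -
  have "sin (real k * t + t) = sin (real k * t - t)"
    using assms(2) sin_t_pos by (simp add: R_def turn_def field_simps)
  then have "cos (real k * t) = 0"
    using sin_t_pos by (simp add: sin_add sin_diff)
  then have "cos (real k * t) = cos (pi / 2)" by simp
  moreover have "0 \<le> real k * t" "real k * t \<le> pi" "0 \<le> pi / 2" "pi / 2 \<le> pi"
    using multiple_less_pi[OF assms(1)] t_pos by simp_all
  ultimately have "real k * t = pi / 2" by (metis cos_inj_pi)
  then have "real p * t = real (2 * k) * t" using p_t by simp
  then have "real p = real (2 * k)" using t_pos by simp
  then show ?thesis by (simp only: of_nat_eq_iff)
qed

text \<open>Cyclic permutation shortens the word.  An \<open>R k\<close> on the right is moved to the left, where it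
  merges with the rotation in the first letter; an \<open>S\<close> on the left is moved to the right, where it cancels
  against the last letter or, if \<open>k > 0\<close>, completes \<open>R k\<close> to a further letter.  The process ends
  with \<open>S\<close>, with a power of \<open>R 1\<close>, or with a word, whose trace is positive.\<close>

lemma trace_zero_word:
  assumes "letters ks" "k < p"
  shows "trace (word ks ** R k) = 0 \<Longrightarrow> \<exists>B. conj_rel (word ks ** R k) B \<and> half_turn B"
    and "trace (S ** (word ks ** R k)) = 0 \<Longrightarrow>
      \<exists>B. conj_rel (S ** (word ks ** R k)) B \<and> half_turn B"
  using assms
proof (induction "length ks" arbitrary: ks k rule: less_induct)
  case less
  note IH = less(1,2)
  {
    case 1
    show ?case
    proof (cases "k = 0")
      case True
      then show ?thesis using 1 trace_word_pos[of ks] by (simp add: R_0)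
    next
      case False
      show ?thesis
      proof (cases ks)
        case Nil
        have "p = 2 * k" using trace_zero_R[of k] 1 Nil by simp
        then have "p div 2 = k" "even p" by simp_all
        then have "half_turn (R k)" by (simp add: half_turn_def)
        then show ?thesis using conj_rel_refl Nil by auto
      next
        case (Cons j ls)
        have j: "j < p" "letters ls" using 1 Cons by auto
        have "conj_rel (R j ** (- S ** word ls ** R k)) (- S ** word ls ** R k ** R j)"
          by (rule conj_rel_cyclic[OF lifts_R])
        moreover have "R j ** (- S ** word ls ** R k) = word ks ** R k"
          by (simp add: Cons V_def minus_matrix_mult matrix_mul_assoc)
        moreover have "- S ** word ls ** R k ** R j = - (S ** (word ls ** R (k + j)))"
          by (simp add: minus_matrix_mult matrix_mul_assoc[symmetric] R_add)
        ultimately have c: "conj_rel (word ks ** R k) (- (S ** (word ls ** R (k + j))))"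
          by simp
        obtain i where i: "i < p" "R (k + j) = R i \<or> R (k + j) = - R i"
        proof (cases "k + j < p")
          case True
          then show ?thesis using that by blast
        next
          case False
          then show ?thesis using that[of "k + j - p"] R_add_p[of "k + j - p"] 1 j by auto
        qed
        then have c': "conj_rel (word ks ** R k) (S ** (word ls ** R i)) \<or>
            conj_rel (word ks ** R k) (- (S ** (word ls ** R i)))"
          using c by (auto simp: minus_matrix_mult)
        then have "trace (S ** (word ls ** R i)) = 0"
          using conj_rel_trace 1 by (fastforce simp: trace_minus)
        then obtain B where "conj_rel (S ** (word ls ** R i)) B" "half_turn B"
          using IH(2)[of ls i] j i Cons by auto
        then show ?thesis
          using c' conj_rel_trans[OF _ conj_rel_minus] conj_rel_trans half_turn_minus by blast
      qed
    qed
  next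
    case 2
    show ?case
    proof (cases "k = 0")
      case False
      have "conj_rel (S ** (word ks ** R k)) (word ks ** R k ** S)"
        by (rule conj_rel_cyclic[OF lifts_S])
      moreover have "word ks ** R k ** S = - word (ks @ [k])"
        by (simp add: word_append matrix_mul_assoc[symmetric] R_S minus_matrix_mult)
      ultimately have "trace (word (ks @ [k])) = 0"
        using conj_rel_trace 2 by (fastforce simp: trace_minus)
      then show ?thesis using trace_word_pos[of "ks @ [k]"] 2 False by auto
    next
      case True
      show ?thesis
      proof (cases ks rule: rev_cases)
        case Nil
        then show ?thesis using True conj_rel_refl by (auto simp: R_0 half_turn_def)
      next
        case (snoc ls j)
        have "conj_rel (S ** (word ks ** R k)) (word ks ** R k ** S)"
          by (rule conj_rel_cyclic[OF lifts_S])
        moreover have "word ks ** R k ** S = word ls ** R j"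
          by (simp add: snoc True R_0 word_append matrix_mul_assoc[symmetric] V_S)
        ultimately have c: "conj_rel (S ** (word ks ** R k)) (word ls ** R j)" by simp
        then have "trace (word ls ** R j) = 0" using conj_rel_trace 2 by metis
        then obtain B where "conj_rel (word ls ** R j) B" "half_turn B"
          using IH(1)[of ls j] 2 snoc by auto
        then show ?thesis using conj_rel_trans[OF c] by blast
      qed
    qed
  }
qed

lemma trace_zero_conj_half_turn:
  assumes "A \<in> lifts" "trace A = 0"
  shows "\<exists>B. conj_rel A B \<and> half_turn B"
  using lifts_normal_form[OF assms(1)] assms(2)
proof induction
  case (minus A)
  then obtain B where "conj_rel A B" "half_turn B" by (auto simp: trace_minus)
  then have "conj_rel (- A) (- B)" "half_turn (- B)"
    by (simp_all only: conj_rel_minus half_turn_minus)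
  then show ?case by blast
qed (rule trace_zero_word; assumption)+

section \<open>The stabilizer of infinity\<close>

text \<open>As all entries are nonnegative and the diagonal is positive, a zero below the diagonal of the
  product forces one in each letter, and only \<open>V 1\<close> has it.\<close>

lemma word_upper_triangular:
  assumes "letters ks" "word ks = mat2 a b 0 d"
  shows "a = 1 \<and> d = 1"
  using assms
proof (induction ks arbitrary: a b d)
  case Nil
  then show ?case by (simp add: mat_1_mat2)
next
  case (Cons k ks)
  obtain x y z w where W: "word ks = mat2 x y z w" by (cases "word ks")
  have k: "0 < k" "k < p" using Cons.prems by auto
  have W_pos: "x > 0 \<and> y \<ge> 0 \<and> z \<ge> 0 \<and> w > 0" using Cons word_pos[OF _ W] by auto
  have pos: "sin (real k * t) > 0" "sin (real k * t - t) \<ge> 0"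
    using sin_multiple_pos[of k] sin_multiple_nonneg[of "k - 1"] k
    by (simp_all add: algebra_simps of_nat_diff)
  have "sin (real k * t - t) * x + sin (real k * t) * z = 0"
    using Cons.prems(2) sin_t_pos by (simp add: V_mat2 W field_simps)
  then have 0: "sin (real k * t - t) = 0" "z = 0"
    using pos W_pos by (auto simp: add_nonneg_eq_0_iff)
  have "k = 1"
  proof (rule ccontr)
    assume "k \<noteq> 1"
    then show False using sin_multiple_pos[of "k - 1"] k 0
      by (simp add: algebra_simps of_nat_diff less_imp_diff_less)
  qed
  then show ?case
    using Cons.IH[of x y w] Cons.prems W 0 V_1 by simp
qed

text \<open>The mirror image of \<open>word_upper_triangular\<close>: the letter is now \<open>V (p - 1)\<close>.\<close>

lemma word_lower_triangular:
  assumes "letters ks" "word ks = mat2 a 0 c d"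
  shows "a = 1 \<and> d = 1"
  using assms
proof (induction ks arbitrary: a c d)
  case Nil
  then show ?case by (simp add: mat_1_mat2)
next
  case (Cons k ks)
  obtain x y z w where W: "word ks = mat2 x y z w" by (cases "word ks")
  have k: "0 < k" "k < p" using Cons.prems by auto
  have W_pos: "x > 0 \<and> y \<ge> 0 \<and> z \<ge> 0 \<and> w > 0" using Cons word_pos[OF _ W] by auto
  have pos: "sin (real k * t) > 0" "sin (real k * t + t) \<ge> 0"
    using sin_multiple_pos[of k] sin_multiple_nonneg[of "k + 1"] k
    by (simp_all add: algebra_simps)
  have "sin (real k * t) * y + sin (real k * t + t) * w = 0"
    using Cons.prems(2) sin_t_pos by (simp add: V_mat2 W field_simps)
  then have 0: "sin (real k * t + t) = 0" "y = 0"
    using pos W_pos by (auto simp: add_nonneg_eq_0_iff)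
  have "k + 1 = p"
  proof (rule ccontr)
    assume "k + 1 \<noteq> p"
    then show False using sin_multiple_pos[of "k + 1"] k 0 by (simp add: algebra_simps)
  qed
  then have "real k * t = pi - t" using p_t by (auto simp: algebra_simps)
  then show ?case
    using Cons.IH[of x z w] Cons.prems W 0 sin_t_pos by (simp add: V_mat2)
qed

text \<open>An element that fixes \<open>\<infinity>\<close> is parabolic or trivial.  In the normal form \<open>W ** R k\<close> the first column
  of \<open>R k\<close> is nonnegative, so nothing can cancel in the lower left entry: \<open>k = 0\<close> and \<open>W\<close> is
  upper triangular.  With \<open>S\<close> in front, likewise, \<open>k = p - 1\<close> and \<open>W\<close> is lower triangular.\<close>

lemma trace_upper_triangular:
  assumes "A \<in> lifts" "A $ 2 $ 1 = 0"
  shows "\<bar>trace A\<bar> = 2"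
  using lifts_normal_form[OF assms(1)] assms(2)
proof induction
  case (plain ks k)
  obtain x y z w where W: "word ks = mat2 x y z w" by (cases "word ks")
  have W_pos: "x > 0 \<and> y \<ge> 0 \<and> z \<ge> 0 \<and> w > 0" using plain word_pos[OF _ W] by auto
  have pos: "sin (real k * t) \<ge> 0" "sin (real k * t + t) \<ge> 0"
    using sin_multiple_nonneg[of k] sin_multiple_nonneg[of "k + 1"] plain
    by (simp_all add: algebra_simps)
  have "z * sin (real k * t + t) + w * sin (real k * t) = 0"
    using plain sin_t_pos by (simp add: R_def turn_def W field_simps)
  then have 0: "z * sin (real k * t + t) = 0" "sin (real k * t) = 0"
    using pos W_pos by (auto simp: add_nonneg_eq_0_iff)
  then have "k = 0" using sin_multiple_pos[of k] plain by (cases "k = 0") auto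
  then have "z = 0" using 0 sin_t_pos by simp
  then show ?case using word_upper_triangular plain W \<open>k = 0\<close> by (fastforce simp: R_0)
next
  case (flipped ks k)
  obtain x y z w where W: "word ks = mat2 x y z w" by (cases "word ks")
  have W_pos: "x > 0 \<and> y \<ge> 0 \<and> z \<ge> 0 \<and> w > 0" using flipped word_pos[OF _ W] by auto
  have pos: "sin (real k * t) \<ge> 0" "sin (real k * t + t) \<ge> 0"
    using sin_multiple_nonneg[of k] sin_multiple_nonneg[of "k + 1"] flipped
    by (simp_all add: algebra_simps)
  have "x * sin (real k * t + t) + y * sin (real k * t) = 0"
    using flipped sin_t_pos by (simp add: R_def turn_def S_def W field_simps)
  then have 0: "sin (real k * t + t) = 0" "y * sin (real k * t) = 0"
    using pos W_pos by (auto simp: add_nonneg_eq_0_iff)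
  have "k + 1 = p"
  proof (rule ccontr)
    assume "k + 1 \<noteq> p"
    then show False using sin_multiple_pos[of "k + 1"] flipped 0 by (simp add: algebra_simps)
  qed
  then have k: "real k * t = pi - t" using p_t by (auto simp: algebra_simps)
  then have "y = 0" using 0 sin_t_pos by simp
  then have "x = 1" "w = 1" using word_lower_triangular flipped W by blast+
  then show ?case using sin_t_pos \<open>y = 0\<close>
    by (simp add: W R_def turn_def k S_def)
next
  case (minus A)
  then show ?case by (simp add: trace_minus)
qed

text \<open>For \<open>k = (p - 1) / 2\<close> the sines of \<open>k t\<close> and \<open>(k + 1) t\<close> agree, so \<open>R k\<close> maps \<open>\<infinity>\<close>
  to \<open>1\<close>.  Conjugation by \<open>(R k)\<^sup>-\<^sup>1\<close> moves the fixed point \<open>1\<close> of the matrix to \<open>\<infinity>\<close>.\<close>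

lemma not_hyperbolic_fixing_one:
  assumes "odd p" "mat2 a b b a \<in> lifts"
  shows "\<bar>2 * a\<bar> = 2"
proof -
  define k where "k = (p - 1) div 2"
  have p: "p = 2 * k + 1" using assms(1) by (auto simp: k_def elim: oddE)
  have "pi = 2 * (real k * t) + t" using p_t by (simp add: p algebra_simps)
  then have "real k * t + t = pi - real k * t" by simp
  then have col: "sin (real k * t + t) = sin (real k * t)" by (simp only: sin_pi_minus)
  obtain x y z w where R: "R k = mat2 x y z w" by (cases "R k")
  have z: "z = x" using R col by (simp add: R_def turn_def)
  let ?X = "adjugate (R k) ** mat2 a b b a ** R k"
  have "\<bar>trace ?X\<bar> = 2"
    by (rule trace_upper_triangular)
      (simp_all add: lifts_mult lifts_adjugate lifts_R assms(2), simp add: R z algebra_simps)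
  moreover have "trace ?X = det (R k) * (2 * a)" unfolding R z by (simp add: algebra_simps)
  ultimately show ?thesis by (simp add: det_R)
qed

section \<open>The stabilizer of one for even order\<close>

lemma R_V: "R j ** V k = V (j + k)"
  by (simp add: V_def minus_matrix_mult matrix_mul_assoc R_add)

lemma V_add_p: "V (k + p) = - V k"
  by (simp add: V_def R_add_p minus_matrix_mult)

lemma V_p: "V p = S"
  using V_add_p[of 0] by (simp add: V_def R_0)

text \<open>Right multiplication by \<open>V m\<close> either turns the final rotation \<open>R k\<close> into a letter or, when
  \<open>k = m\<close>, produces \<open>R m ** V m = S\<close>, which cancels against the last letter.  Cancellation can only
  happen as often as there are letters, so some power of \<open>V m\<close> removes the final rotation.\<close>

lemma absorb_tail:
  assumes "p = 2 * m" "letters ks" "k < p"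
  shows "\<exists>n ls. letters ls \<and> (word ks ** R k ** word (replicate n m) = word ls \<or>
    word ks ** R k ** word (replicate n m) = - word ls \<or>
    word ks ** R k ** word (replicate n m) = S ** word ls)"
  (is "\<exists>n ls. ?absorbed ks k n ls")
proof -
  have *: "\<exists>n ls. ?absorbed ks k n ls" if "letters ks" "k < p" "k \<noteq> m" for ks k
  proof (cases "k = 0")
    case True
    then show ?thesis using that by (intro exI[of _ 0] exI[of _ ks]) (simp add: R_0)
  next
    case False
    obtain i where i: "i \<in> {1..<p}" "V (k + m) = V i \<or> V (k + m) = - V i"
    proof (cases "k + m < p")
      case True
      then show ?thesis using that[of "k + m"] False by auto
    next
      case False
      then have "V (k + m) = - V (k + m - p)" using V_add_p[of "k + m - p"] by simp
      moreover have "k + m - p \<in> {1..<p}"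
        using False \<open>k < p\<close> \<open>k \<noteq> m\<close> assms(1) by auto
      ultimately show ?thesis using that by blast
    qed
    have "word ks ** R k ** word (replicate 1 m) = word ks ** V (k + m)"
      by (simp add: matrix_mul_assoc[symmetric] R_V)
    then have "?absorbed ks k 1 (ks @ [i])"
      using i that by (auto simp: word_append minus_matrix_mult)
    then show ?thesis by blast
  qed
  \<comment> \<open>The case \<open>k = m\<close>, in which the middle letter cancels.\<close>
  have R_m: "R m ** V m = S"
    using V_p assms(1) R_V[of m m] by (metis mult_2)
  show ?thesis
    using assms(2,3)
  proof (induction ks arbitrary: k rule: rev_induct)
    case Nil
    have "?absorbed [] m 1 []" by (simp add: R_m)
    then show ?case using *[of "[]" k] Nil by blast
  next
    case (snoc j ks)
    then have "letters ks" "j < p" by auto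
    from snoc.IH[OF this] obtain n ls where n: "?absorbed ks j n ls" by (elim exE)
    have "word (ks @ [j]) ** R m ** word (replicate (Suc n) m)
        = word ks ** (V j ** (R m ** V m)) ** word (replicate n m)"
      by (simp add: word_append matrix_mul_assoc)
    also have "\<dots> = word ks ** R j ** word (replicate n m)"
      by (simp add: R_m V_S)
    finally have "?absorbed (ks @ [j]) m (Suc n) ls" using n by (simp only:)
    then show ?case using *[of "ks @ [j]" k] snoc.prems by blast
  qed
qed

text \<open>The difference of the two sines is a positive multiple of
  \<open>cos ((2 k + 1) t / 2)\<close>, which changes its sign at \<open>2 k + 1 = p\<close>.\<close>

lemma sin_step_iff:
  assumes "k < p"
  shows "sin (real k * t) < sin (real k * t + t) \<longleftrightarrow> 2 * k + 1 < p"
    and "sin (real k * t + t) < sin (real k * t) \<longleftrightarrow> p < 2 * k + 1"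
proof -
  have d: "sin (real k * t + t) - sin (real k * t) = 2 * sin (t / 2) * cos (real k * t + t / 2)"
    using sin_diff_sin[of "real k * t + t" "real k * t"] by (simp add: field_simps)
  have s: "sin (t / 2) > 0"
    using t_pos multiple_less_pi[of 1] p_ge by (intro sin_gt_zero) auto
  have pi2: "real p * (t / 2) = pi / 2" using p_t by simp
  have bounds: "0 \<le> real k * t + t / 2" "real k * t + t / 2 \<le> pi"
  proof -
    have "real (k + 1) * t \<le> real p * t"
      using assms t_pos by (intro mult_right_mono) auto
    then show "0 \<le> real k * t + t / 2" "real k * t + t / 2 \<le> pi"
      using t_pos p_t by (auto simp: algebra_simps)
  qed
  have "cos (pi / 2) < cos (real k * t + t / 2) \<longleftrightarrow> real (2 * k + 1) * (t / 2) < real p * (t / 2)"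
    unfolding pi2 using bounds
    by (subst cos_mono_less_eq) (auto simp: field_simps)
  moreover have "cos (real k * t + t / 2) < cos (pi / 2) \<longleftrightarrow>
      real p * (t / 2) < real (2 * k + 1) * (t / 2)"
    unfolding pi2 using bounds
    by (subst cos_mono_less_eq) (auto simp: field_simps)
  ultimately have "cos (real k * t + t / 2) > 0 \<longleftrightarrow> 2 * k + 1 < p"
    "cos (real k * t + t / 2) < 0 \<longleftrightarrow> p < 2 * k + 1"
    using t_pos by (auto simp del: of_nat_add of_nat_mult simp: mult_less_cancel_right)
  then show "sin (real k * t) < sin (real k * t + t) \<longleftrightarrow> 2 * k + 1 < p"
    "sin (real k * t + t) < sin (real k * t) \<longleftrightarrow> p < 2 * k + 1"
    using d s by (smt (verit) zero_less_mult_iff mult_less_0_iff)+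
qed

lemma V_middle:
  assumes "p = 2 * m"
  obtains u v where "V m = mat2 u v v u" "u > v"
proof
  have m: "real m * t = pi / 2" using p_t assms by simp
  show "V m = mat2 (1 / sin t) (cos t / sin t) (cos t / sin t) (1 / sin t)"
    unfolding V_mat2 m by (simp add: sin_add sin_diff)
  have "cos t < cos 0" using t_pos multiple_less_pi[of 1] p_ge by (intro cos_monotone_0_pi) auto
  then show "1 / sin t > cos t / sin t" using sin_t_pos by (simp add: divide_strict_right_mono)
qed

text \<open>The letters map \<open>(0, \<infinity>)\<close> to disjoint intervals, and \<open>1\<close> lies in the one that belongs to the
  middle letter \<open>V m\<close>.  Hence the first letter of a word that fixes \<open>1\<close> is \<open>V m\<close>, and as \<open>V m\<close>
  itself fixes \<open>1\<close> the same applies to the rest of the word.  The image of \<open>1\<close> under a matrix is the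
  quotient of its row sums.\<close>

lemma word_fixing_one:
  assumes "p = 2 * m" "letters ks" "word ks = mat2 a b c d" "a + b = c + d"
  shows "a = d \<and> b = c"
  using assms(2-4)
proof (induction ks arbitrary: a b c d)
  case Nil
  then show ?case by (simp add: mat_1_mat2)
next
  case (Cons k ks)
  obtain x y z w where W: "word ks = mat2 x y z w" by (cases "word ks")
  have k: "0 < k" "k < p" using Cons.prems by auto
  have "x > 0 \<and> y \<ge> 0 \<and> z \<ge> 0 \<and> w > 0" using Cons word_pos[OF _ W] by auto
  then have uv: "x + y > 0" "z + w > 0" by auto
  let ?s = "sin (real k * t)" and ?s' = "sin (real k * t + t)" and ?r = "sin (real k * t - t)"
  have eq: "(?s - ?r) * (x + y) = (?s - ?s') * (z + w)"
  proof -
    have "a * sin t = ?s * x + ?s' * z" "b * sin t = ?s * y + ?s' * w"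
      "c * sin t = ?r * x + ?s * z" "d * sin t = ?r * y + ?s * w"
      using Cons.prems(2) sin_t_pos by (auto simp: V_mat2 W field_simps)
    moreover have "a * sin t + b * sin t = c * sin t + d * sin t"
      using Cons.prems(3) by (metis distrib_right)
    ultimately show ?thesis by (simp add: algebra_simps)
  qed
  have prev: "real (k - 1) * t = real k * t - t"
    using k by (simp add: algebra_simps of_nat_diff)
  have "k - 1 < p" using k by simp
  from sin_step_iff[OF this] have r: "?r < ?s \<longleftrightarrow> 2 * (k - 1) + 1 < p"
    "?s < ?r \<longleftrightarrow> p < 2 * (k - 1) + 1"
    unfolding prev diff_add_cancel .
  have "k = m"
  proof (rule ccontr)
    assume "k \<noteq> m"
    then consider "k < m" | "m < k" by linarith
    then show False
    proof cases
      case 1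
      then have "?s - ?r > 0" "?s - ?s' < 0"
        using r sin_step_iff[OF k(2)] assms(1) by auto
      then show False using eq uv by (smt (verit) mult_pos_pos mult_neg_pos)
    next
      case 2
      then have "?s - ?r < 0" "?s - ?s' > 0"
        using r sin_step_iff[OF k(2)] assms(1) by auto
      then show False using eq uv by (smt (verit) mult_pos_pos mult_neg_pos)
    qed
  qed
  obtain u v where V: "V m = mat2 u v v u" "u > v" using V_middle[OF assms(1)] .
  have "(u - v) * (x + y) = (u - v) * (z + w)"
    using Cons.prems \<open>k = m\<close> by (simp add: V W algebra_simps)
  then have "x + y = z + w" using V(2) by simp
  then have "x = w \<and> y = z" using Cons.IH[of x y z w] Cons.prems W by simp
  then show ?case using Cons.prems \<open>k = m\<close> by (auto simp: V W)
qed

lemma word_replicate_middle: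
  assumes "p = 2 * m"
  obtains x y where "word (replicate n m) = mat2 x y y x"
proof (induction n arbitrary: thesis)
  case 0
  then show ?case by (simp add: mat_1_mat2)
next
  case (Suc n)
  obtain x y where W: "word (replicate n m) = mat2 x y y x" using Suc.IH .
  obtain u v where V: "V m = mat2 u v v u" using V_middle[OF assms] .
  show ?case by (rule Suc.prems[of "u * x + v * y" "u * y + v * x"]) (simp add: V W)
qed

text \<open>The right factor \<open>V m\<^sup>n\<close> of \<open>absorb_tail\<close> fixes \<open>1\<close>, so the resulting word fixes \<open>1\<close>; a
  leading \<open>S\<close> is impossible, since it would make the image of \<open>1\<close> negative.  By \<open>word_fixing_one\<close> the
  word has the shape \<open>mat2 x y y x\<close>, and this shape is preserved when \<open>V m\<^sup>n\<close> is divided out.\<close>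

lemma fixing_one_even:
  assumes p: "p = 2 * m" and "A \<in> lifts" "A $ 1 $ 1 + A $ 1 $ 2 = A $ 2 $ 1 + A $ 2 $ 2"
  shows "A $ 1 $ 1 = A $ 2 $ 2 \<and> A $ 1 $ 2 = A $ 2 $ 1"
proof -
  have word_case: "a = d \<and> b = c"
    if "letters ls" "word ls = mat2 a b c d \<or> - word ls = mat2 a b c d \<or>
      S ** word ls = mat2 a b c d \<or> - (S ** word ls) = mat2 a b c d" "a + b = c + d"
    for ls a b c d
  proof -
    obtain x y z w where W: "word ls = mat2 x y z w" by (cases "word ls")
    have "x > 0 \<and> y \<ge> 0 \<and> z \<ge> 0 \<and> w > 0" using that word_pos[OF _ W] by auto
    then show ?thesis
      using that word_fixing_one[OF p that(1) W] by (auto simp: W S_def)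
  qed
  have key: "a = d \<and> b = c"
    if ks: "letters ks" "k < p" and "a + b = c + d"
      "mat2 a b c d = word ks ** R k \<or> mat2 a b c d = S ** (word ks ** R k)" for a b c d ks k
  proof -
    obtain n ls where n: "letters ls" "word ks ** R k ** word (replicate n m) = word ls \<or>
        word ks ** R k ** word (replicate n m) = - word ls \<or>
        word ks ** R k ** word (replicate n m) = S ** word ls"
      using absorb_tail[OF p ks] by blast
    obtain x y where T: "word (replicate n m) = mat2 x y y x" using word_replicate_middle[OF p] .
    let ?C = "mat2 a b c d ** word (replicate n m)"
    obtain a' b' c' d' where C: "?C = mat2 a' b' c' d'" by (cases ?C)
    have "?C = word ls \<or> ?C = - word ls \<or> ?C = S ** word ls \<or> ?C = - (S ** word ls)"
      using that(4)
    proof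
      assume "mat2 a b c d = word ks ** R k"
      then show ?thesis using n(2) by metis
    next
      assume "mat2 a b c d = S ** (word ks ** R k)"
      then have "?C = S ** (word ks ** R k ** word (replicate n m))"
        by (simp add: matrix_mul_assoc)
      moreover have "S ** (S ** word ls) = - word ls"
        by (simp add: matrix_mul_assoc S_S minus_matrix_mult)
      ultimately show ?thesis using n(2) by (auto simp: minus_matrix_mult)
    qed
    moreover have "a' + b' = c' + d'"
    proof -
      have "a' + b' = (a + b) * (x + y)" "c' + d' = (c + d) * (x + y)"
        using C by (simp_all add: T algebra_simps)
      then show ?thesis using that(3) by simp
    qed
    ultimately have sym: "a' = d' \<and> b' = c'"
      using word_case[OF n(1), of a' b' c' d'] unfolding C by metis
    have "mat2 a b c d = ?C ** adjugate (word (replicate n m))"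
      by (simp add: matrix_mul_assoc[symmetric] adjugate_inverse lifts_det[OF lifts_word])
    then show ?thesis unfolding C using sym by (simp add: T)
  qed
  from lifts_normal_form[OF assms(2)] assms(3) show ?thesis
  proof induction
    case (plain ks k)
    then show ?case using key[of ks k] by (metis mat2_collapse)
  next
    case (flipped ks k)
    then show ?case using key[of ks k] by (metis mat2_collapse)
  next
    case (minus A)
    then show ?case by simp
  qed
qed

section \<open>Reciprocal elements\<close>

lemma lift_exists:
  assumes "g \<in> carrier (Hecke_group p)"
  obtains A where "A \<in> lifts" "g = psl A"
proof -
  have "{iota, alpha p} \<subseteq> carrier PSL2R" by (simp add: generators_in_PSL2R)
  from group.generate_in_carrier[OF group_PSL2R this] assms
  have "g \<in> carrier PSL2R" by (simp add: carrier_Hecke_group)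
  then obtain A where "det A = 1" "g = psl A" unfolding carrier_PSL2R by blast
  then show ?thesis using assms that[of A] by (simp add: lifts_def)
qed

lemma lifts_carrier: "A \<in> lifts \<Longrightarrow> psl A \<in> carrier (Hecke_group p)"
  by (simp add: lifts_def)

lemma Hecke_mult:
  "A \<in> lifts \<Longrightarrow> B \<in> lifts \<Longrightarrow> psl A \<otimes>\<^bsub>Hecke_group p\<^esub> psl B = psl (A ** B)"
  by (simp add: Hecke_group_def psl_mult lifts_det)

lemma Hecke_inv:
  "A \<in> lifts \<Longrightarrow> inv\<^bsub>Hecke_group p\<^esub> psl A = psl (adjugate A)"
  using group.inv_subgroup_generated[OF group_PSL2R, of "psl A" "{iota, alpha p}"] lifts_carrier[of A]
  by (simp add: Hecke_group_def psl_inv lifts_det)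

lemma Hecke_conj:
  assumes "X \<in> lifts" "A \<in> lifts"
  shows "psl X \<otimes>\<^bsub>Hecke_group p\<^esub> psl A \<otimes>\<^bsub>Hecke_group p\<^esub> inv\<^bsub>Hecke_group p\<^esub> psl X
    = psl (X ** A ** adjugate X)"
  using assms by (simp add: Hecke_inv Hecke_mult lifts_mult lifts_adjugate)

text \<open>Reciprocity in terms of lifts: equality in \<open>PSL2R\<close> leaves the sign open.\<close>

definition reversible :: "real^2^2 \<Rightarrow> bool" where
  "reversible A \<longleftrightarrow> (\<exists>H\<in>lifts. H ** A ** adjugate H = adjugate A \<or>
     H ** A ** adjugate H = - adjugate A)"

lemma reciprocal_iff_reversible:
  assumes "A \<in> lifts"
  shows "reciprocal (Hecke_group p) (psl A) \<longleftrightarrow> reversible A"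
proof
  assume "reciprocal (Hecke_group p) (psl A)"
  then obtain h where h: "h \<in> carrier (Hecke_group p)" "inv\<^bsub>Hecke_group p\<^esub> psl A =
      h \<otimes>\<^bsub>Hecke_group p\<^esub> psl A \<otimes>\<^bsub>Hecke_group p\<^esub> inv\<^bsub>Hecke_group p\<^esub> h"
    by (auto simp: reciprocal_def)
  obtain H where "H \<in> lifts" "h = psl H" using lift_exists[OF h(1)] .
  then have "psl (H ** A ** adjugate H) = psl (adjugate A)"
    using h(2) Hecke_conj[OF \<open>H \<in> lifts\<close> assms] Hecke_inv[OF assms] by metis
  then show "reversible A"
    using \<open>H \<in> lifts\<close> by (auto simp: reversible_def psl_eq_iff)
next
  assume "reversible A"
  then obtain H where H: "H \<in> lifts" "psl (H ** A ** adjugate H) = psl (adjugate A)"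
    by (auto simp: reversible_def psl_eq_iff)
  show "reciprocal (Hecke_group p) (psl A)"
    unfolding reciprocal_def
  proof (intro conjI bexI)
    show "inv\<^bsub>Hecke_group p\<^esub> psl A =
        psl H \<otimes>\<^bsub>Hecke_group p\<^esub> psl A \<otimes>\<^bsub>Hecke_group p\<^esub> inv\<^bsub>Hecke_group p\<^esub> psl H"
      using H(2) Hecke_conj[OF H(1) assms] Hecke_inv[OF assms] by metis
  qed (use H assms lifts_carrier in auto)
qed

lemma involution_iff:
  assumes "A \<in> lifts"
  shows "involution (Hecke_group p) (psl A) \<longleftrightarrow> A ** A = mat 1 \<or> A ** A = - mat 1"
proof -
  interpret group "Hecke_group p" by (rule group_Hecke_group)
  have "psl A [^]\<^bsub>Hecke_group p\<^esub> (2::nat) = psl (A ** A)"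
    using assms lifts_carrier[OF assms] by (simp add: numeral_2_eq_2 Hecke_mult)
  moreover have "\<one>\<^bsub>Hecke_group p\<^esub> = psl (mat 1)"
    by (simp add: Hecke_group_def psl_one)
  ultimately show ?thesis
    using lifts_carrier[OF assms] by (simp add: involution_def psl_eq_iff)
qed

lemma involution_reversible:
  assumes "A \<in> lifts" "A ** A = mat 1 \<or> A ** A = - mat 1"
  shows "reversible A"
proof -
  have "adjugate A ** (A ** A) = A" "A ** A ** adjugate A = A"
    by (simp_all add: matrix_mul_assoc adjugate_inverse lifts_det[OF assms(1)])
      (simp add: matrix_mul_assoc[symmetric] adjugate_inverse lifts_det[OF assms(1)])
  then have "A ** A ** adjugate A = adjugate A \<or> A ** A ** adjugate A = - adjugate A"
    using assms(2) by (auto simp: minus_matrix_mult)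
  then show ?thesis using assms(1) by (auto simp: reversible_def)
qed

lemma reversible_conj:
  assumes "X \<in> lifts" "reversible (X ** A ** adjugate X)"
  shows "reversible A"
proof -
  let ?B = "X ** A ** adjugate X"
  obtain H where H: "H \<in> lifts" "H ** ?B ** adjugate H = adjugate ?B \<or>
      H ** ?B ** adjugate H = - adjugate ?B"
    using assms(2) by (auto simp: reversible_def)
  let ?K = "adjugate X ** H ** X"
  have aa: "adjugate (adjugate M) = M" for M by (cases M) simp
  have cancel: "adjugate X ** (X ** M) = M" for M
    by (simp add: matrix_mul_assoc adjugate_inverse lifts_det[OF assms(1)])
  have "?K ** A ** adjugate ?K = adjugate X ** (H ** ?B ** adjugate H) ** X"
    by (simp add: adjugate_mult aa matrix_mul_assoc)
  moreover have "adjugate X ** adjugate ?B ** X = adjugate A"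
    by (simp add: adjugate_mult aa matrix_mul_assoc[symmetric] cancel adjugate_inverse
        lifts_det[OF assms(1)])
  ultimately have "?K ** A ** adjugate ?K = adjugate A \<or> ?K ** A ** adjugate ?K = - adjugate A"
    using H(2) by (auto simp: minus_matrix_mult)
  moreover have "?K \<in> lifts" by (simp add: H(1) assms(1) lifts_adjugate lifts_mult)
  ultimately show ?thesis by (auto simp: reversible_def)
qed

lemma R_middle:
  assumes "even p"
  shows "R (p div 2) = mat2 (cos t / sin t) (- 1 / sin t) (1 / sin t) (- cos t / sin t)"
proof -
  have "real (p div 2) * t = pi / 2"
    using p_t assms by (simp add: real_of_nat_div)
  then show ?thesis unfolding R_def turn_def by (simp only:) (simp add: sin_add sin_diff)
qed

lemma reversible_symmetric:
  assumes "B $ 1 $ 2 = B $ 2 $ 1"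
  shows "reversible B"
proof -
  have "trace (S ** B) = 0" using assms by (cases B) (simp add: S_def)
  then have "S ** B ** adjugate S = adjugate B"
    by (intro reversed_by_half_turn) (simp_all add: S_def)
  then show ?thesis using lifts_S by (auto simp: reversible_def)
qed

text \<open>The reversing half turn is \<open>R (p div 2)\<close> conjugated by \<open>S\<close>, with fixed point
  \<open>- exp (- \<i> t)\<close> instead of \<open>exp (\<i> t)\<close>; without the conjugation \<open>- cos t\<close> would appear in place
  of \<open>cos t\<close>.\<close>

lemma reversible_by_middle:
  assumes "even p" "B $ 1 $ 2 - B $ 2 $ 1 = cos t * (B $ 1 $ 1 - B $ 2 $ 2)"
  shows "reversible B"
proof -
  let ?H = "S ** R (p div 2) ** adjugate S"
  have H: "?H = mat2 (- cos t / sin t) (- 1 / sin t) (1 / sin t) (cos t / sin t)"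
    by (simp add: R_middle[OF assms(1)] S_def)
  have "trace (?H ** B)
      = (B $ 1 $ 2 - B $ 2 $ 1 - cos t * (B $ 1 $ 1 - B $ 2 $ 2)) / sin t"
    unfolding H using sin_t_pos by (cases B) (simp add: field_simps)
  then have "trace (?H ** B) = 0" using assms(2) by simp
  moreover have "?H \<in> lifts" by (simp add: lifts_S lifts_R lifts_mult lifts_adjugate)
  moreover have "trace ?H = 0" unfolding H by simp
  ultimately have "?H ** B ** adjugate ?H = adjugate B"
    by (intro reversed_by_half_turn) (simp_all add: lifts_det)
  then show ?thesis using \<open>?H \<in> lifts\<close> by (auto simp: reversible_def)
qed

text \<open>The reversing half turn is conjugate to \<open>S\<close> or \<open>R (p div 2)\<close> up to sign; when \<open>A\<close> is conjugated
  along with it, \<open>trace (H ** A) = 0\<close> becomes the stated relation between the entries.\<close>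

lemma reversible_cases:
  assumes "A \<in> lifts" "reversible A"
  obtains "A ** A = mat 1 \<or> A ** A = - mat 1"
  | X B where "X \<in> lifts" "B = X ** A ** adjugate X" "\<bar>trace B\<bar> > 2"
      "B $ 1 $ 2 = B $ 2 $ 1 \<or>
       even p \<and> B $ 1 $ 2 - B $ 2 $ 1 = cos t * (B $ 1 $ 1 - B $ 2 $ 2)"
proof -
  obtain H where H: "H \<in> lifts" "H ** A ** adjugate H = adjugate A \<or>
      H ** A ** adjugate H = - adjugate A"
    using assms(2) by (auto simp: reversible_def)
  from lifts_det[OF assms(1)] lifts_det[OF H(1)] H(2) show ?thesis
  proof (cases rule: reversed_cases)
    case 1
    then show ?thesis using that(1) by (auto simp: minus_matrix_mult)
  next
    case 2
    obtain a b c d where A: "A = mat2 a b c d" by (cases A)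
    have "d = - a" using 2 by (simp add: A)
    then have "A ** A = - mat 1"
      using lifts_det[OF assms(1)] by (simp add: A mat_1_mat2 algebra_simps)
    then show ?thesis using that(1) by blast
  next
    case 3
    obtain K X where X: "X \<in> lifts" "K = X ** H ** adjugate X" "half_turn K"
      using trace_zero_conj_half_turn[OF H(1) 3(1)] by (auto simp: conj_rel_def)
    let ?B = "X ** A ** adjugate X"
    have "K ** ?B = X ** H ** (adjugate X ** X) ** A ** adjugate X"
      unfolding X(2) by (simp only: matrix_mul_assoc)
    also have "\<dots> = X ** (H ** A) ** adjugate X"
      by (simp add: adjugate_inverse lifts_det[OF X(1)] matrix_mul_assoc)
    finally have "conj_rel (H ** A) (K ** ?B)" using X(1) by (auto simp: conj_rel_def)
    then have KB: "trace (K ** ?B) = 0" using conj_rel_trace 3(2) by metis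
    have "conj_rel A ?B" using X(1) by (auto simp: conj_rel_def)
    then have hyp: "\<bar>trace ?B\<bar> > 2" using conj_rel_trace 3(3) by metis
    obtain a b c d where B: "?B = mat2 a b c d" by (cases ?B)
    from X(3) consider "K = S \<or> K = - S"
      | "even p" "K = R (p div 2) \<or> K = - R (p div 2)"
      by (auto simp: half_turn_def)
    then show ?thesis
    proof cases
      case 1
      then have "b = c" using KB unfolding B by (auto simp: S_def)
      then show ?thesis using that(2)[OF X(1) refl hyp] unfolding B by simp
    next
      case 2
      then have eq: "b - c = - (cos t * (a - d))"
        using KB sin_t_pos unfolding B R_middle[OF 2(1)] by (auto simp: field_simps)
      \<comment> \<open>The relation holds with \<open>- cos t\<close>; a further conjugation by \<open>S\<close> changes the sign.\<close>
      let ?C = "S ** X ** A ** adjugate (S ** X)"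
      have C: "?C = mat2 d (- c) (- b) a"
      proof -
        have "?C = S ** ?B ** adjugate S" by (simp add: adjugate_mult matrix_mul_assoc)
        then show ?thesis unfolding B by (simp add: S_def)
      qed
      have "\<bar>trace ?C\<bar> > 2" using hyp unfolding B C by simp
      moreover have "(- c) - (- b) = cos t * (d - a)" using eq by (simp add: algebra_simps)
      ultimately show ?thesis
        using that(2)[OF lifts_mult[OF lifts_S X(1)] refl] 2(1) unfolding C by simp
    qed
  qed
qed

text \<open>Ratio \<open>1\<close> requires \<open>b - c = a - d\<close>, which says that \<open>B\<close> fixes \<open>-1\<close>; then its conjugate
  by \<open>S\<close> fixes \<open>1\<close>.\<close>

lemma fixed_point_ratio_one:
  assumes "even p" "B \<in> lifts" "fixed_point_ratio_mat B = 1"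
  shows "B $ 1 $ 2 = B $ 2 $ 1"
proof -
  obtain a b c d where B: "B = mat2 a b c d" by (cases B)
  have "b - c = a - d"
    using assms(3) by (auto simp: fixed_point_ratio_mat_def B one_ereal_def split: if_splits)
  moreover have "S ** B ** adjugate S \<in> lifts"
    by (simp add: assms(2) lifts_S lifts_mult lifts_adjugate)
  moreover have "S ** B ** adjugate S = mat2 d (- c) (- b) a" by (simp add: B S_def)
  moreover have "p = 2 * (p div 2)" using assms(1) by simp
  ultimately show ?thesis
    using fixing_one_even[of "p div 2" "S ** B ** adjugate S"] by (simp add: B)
qed

lemma symmetric_hyperbolic_odd:
  assumes "odd p" "B \<in> lifts" "\<bar>trace B\<bar> > 2" "B $ 1 $ 2 = B $ 2 $ 1"
  shows "B $ 1 $ 1 \<noteq> B $ 2 $ 2"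
proof
  assume eq: "B $ 1 $ 1 = B $ 2 $ 2"
  obtain a b c d where B: "B = mat2 a b c d" by (cases B)
  then have "B = mat2 a b b a" using eq assms(4) by simp
  then show False using not_hyperbolic_fixing_one[OF assms(1), of a b] assms(2,3) by simp
qed

lemma hyperbolic_psl: "B \<in> lifts \<Longrightarrow> hyperbolic (psl B) \<longleftrightarrow> \<bar>trace B\<bar> > 2"
  using psl_carrier[of B] lifts_det[of B] by (auto simp: hyperbolic_def psl_eq trace_minus)

lemma fixed_point_ratio_psl: "B \<in> lifts \<Longrightarrow> fixed_point_ratio (psl B) = fixed_point_ratio_mat B"
  by (rule fixed_point_ratio_lift) (simp add: psl_carrier lifts_det, simp add: psl_eq)

text \<open>The equivalence, with the set \<open>T\<close> of admissible ratios as a parameter: the two parities of \<open>p\<close> differ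
  only in which \<open>T\<close> singles out the matrices that one of the two standard half turns reverses.\<close>

lemma reciprocal_iff:
  assumes g: "g \<in> carrier (Hecke_group p)"
    and conj_reversible: "\<And>B. B \<in> lifts \<Longrightarrow> \<bar>trace B\<bar> > 2 \<Longrightarrow>
      fixed_point_ratio_mat B \<in> T \<longleftrightarrow> B $ 1 $ 2 = B $ 2 $ 1 \<or>
        even p \<and> B $ 1 $ 2 - B $ 2 $ 1 = cos t * (B $ 1 $ 1 - B $ 2 $ 2)"
  shows "reciprocal (Hecke_group p) g \<longleftrightarrow> involution (Hecke_group p) g \<or>
    (\<exists>h\<in>carrier (Hecke_group p). conjugate_in (Hecke_group p) g h \<and>
       hyperbolic h \<and> fixed_point_ratio h \<in> T)"
proof -
  obtain A where A: "A \<in> lifts" "g = psl A" using lift_exists[OF g] .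
  show ?thesis
  proof
    assume "reciprocal (Hecke_group p) g"
    then have "reversible A" using A by (simp add: reciprocal_iff_reversible)
    with A(1) show "involution (Hecke_group p) g \<or>
      (\<exists>h\<in>carrier (Hecke_group p). conjugate_in (Hecke_group p) g h \<and>
         hyperbolic h \<and> fixed_point_ratio h \<in> T)"
    proof (cases rule: reversible_cases)
      case 1
      then show ?thesis using A by (simp add: involution_iff)
    next
      case (2 X B)
      then have B: "B \<in> lifts" using A(1) by (simp add: lifts_mult lifts_adjugate)
      have "conjugate_in (Hecke_group p) g (psl B)"
        unfolding conjugate_in_def
      proof (intro conjI bexI)
        show "psl B = psl X \<otimes>\<^bsub>Hecke_group p\<^esub> g \<otimes>\<^bsub>Hecke_group p\<^esub> inv\<^bsub>Hecke_group p\<^esub> psl X"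
          using 2 A by (simp add: Hecke_conj)
      qed (use g B 2 lifts_carrier in auto)
      moreover have "hyperbolic (psl B)" "fixed_point_ratio (psl B) \<in> T"
        using 2 B conj_reversible[OF B] by (simp_all add: hyperbolic_psl fixed_point_ratio_psl)
      ultimately show ?thesis using lifts_carrier[OF B] by blast
    qed
  next
    assume "involution (Hecke_group p) g \<or>
      (\<exists>h\<in>carrier (Hecke_group p). conjugate_in (Hecke_group p) g h \<and>
         hyperbolic h \<and> fixed_point_ratio h \<in> T)"
    then have "reversible A"
    proof
      assume "involution (Hecke_group p) g"
      then show ?thesis using A involution_iff involution_reversible by auto
    next
      assume "\<exists>h\<in>carrier (Hecke_group p). conjugate_in (Hecke_group p) g h \<and>
        hyperbolic h \<and> fixed_point_ratio h \<in> T"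
      then obtain x where x: "x \<in> carrier (Hecke_group p)"
        "hyperbolic (x \<otimes>\<^bsub>Hecke_group p\<^esub> g \<otimes>\<^bsub>Hecke_group p\<^esub> inv\<^bsub>Hecke_group p\<^esub> x)"
        "fixed_point_ratio (x \<otimes>\<^bsub>Hecke_group p\<^esub> g \<otimes>\<^bsub>Hecke_group p\<^esub> inv\<^bsub>Hecke_group p\<^esub> x) \<in> T"
        by (auto simp: conjugate_in_def)
      obtain X where X: "X \<in> lifts" "x = psl X" using lift_exists[OF x(1)] .
      let ?B = "X ** A ** adjugate X"
      have B: "?B \<in> lifts" using A(1) X(1) by (simp add: lifts_mult lifts_adjugate)
      have "\<bar>trace ?B\<bar> > 2" "fixed_point_ratio_mat ?B \<in> T"
        using x(2,3) A X B
        by (simp_all add: Hecke_conj flip: hyperbolic_psl[OF B] fixed_point_ratio_psl[OF B])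
      then have "reversible ?B"
        using conj_reversible[OF B] reversible_symmetric reversible_by_middle by blast
      then show ?thesis using reversible_conj[OF X(1)] by blast
    qed
    then show "reciprocal (Hecke_group p) g" using A by (simp add: reciprocal_iff_reversible)
  qed
qed

lemma fixed_point_ratio_odd:
  assumes "odd p" "B \<in> lifts" "\<bar>trace B\<bar> > 2"
  shows "fixed_point_ratio_mat B = 0 \<longleftrightarrow> B $ 1 $ 2 = B $ 2 $ 1"
  using symmetric_hyperbolic_odd[OF assms]
  by (auto simp: fixed_point_ratio_mat_def zero_ereal_def[symmetric])

lemma fixed_point_ratio_even:
  assumes "even p" "B \<in> lifts"
  shows "fixed_point_ratio_mat B \<in> {0, 1, ereal (cos t)} \<longleftrightarrow> B $ 1 $ 2 = B $ 2 $ 1 \<or>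
    B $ 1 $ 2 - B $ 2 $ 1 = cos t * (B $ 1 $ 1 - B $ 2 $ 2)"
proof (cases "fixed_point_ratio_mat B = 1")
  case True
  then show ?thesis using fixed_point_ratio_one[OF assms] by simp
next
  case False
  then show ?thesis
    by (auto simp: fixed_point_ratio_mat_def one_ereal_def zero_ereal_def field_simps split: if_splits)
qed

end

theorem theorem1p4:
  fixes p :: nat and g :: "(real^2^2) set"
  assumes "p \<ge> 3" and "g \<in> carrier (Hecke_group p)"
  shows
    "(odd p \<longrightarrow>
        (reciprocal (Hecke_group p) g \<longleftrightarrow>
           involution (Hecke_group p) g \<or>
           (\<exists>h\<in>carrier (Hecke_group p). conjugate_in (Hecke_group p) g h \<and>
              hyperbolic h \<and> fixed_point_ratio h = 0)) \<and>
        (\<forall>h\<in>carrier (Hecke_group p). hyperbolic h \<longrightarrow>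
           (fixed_point_ratio h = 0 \<longleftrightarrow> (\<forall>A\<in>h. transpose A = A)))) \<and>
     (even p \<longrightarrow>
        (reciprocal (Hecke_group p) g \<longleftrightarrow>
           involution (Hecke_group p) g \<or>
           (\<exists>h\<in>carrier (Hecke_group p). conjugate_in (Hecke_group p) g h \<and>
              hyperbolic h \<and> fixed_point_ratio h \<in> {0, 1, ereal (cos (pi / real p))})))"
proof -
  interpret hecke p by unfold_locales (rule assms(1))
  have symmetric: "fixed_point_ratio h = 0 \<longleftrightarrow> (\<forall>A\<in>h. transpose A = A)"
    if "odd p" and h: "h \<in> carrier (Hecke_group p)" "hyperbolic h" for h
  proof -
    obtain B where B: "B \<in> lifts" "h = psl B" using lift_exists[OF h(1)] .
    have "transpose B = B \<longleftrightarrow> B $ 1 $ 2 = B $ 2 $ 1" "transpose (- B) = - B \<longleftrightarrow> B $ 1 $ 2 = B $ 2 $ 1"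
      by (cases B; auto)+
    then have "(\<forall>A\<in>h. transpose A = A) \<longleftrightarrow> B $ 1 $ 2 = B $ 2 $ 1"
      unfolding B(2) psl_eq by simp
    moreover have "fixed_point_ratio h = 0 \<longleftrightarrow> B $ 1 $ 2 = B $ 2 $ 1"
      using fixed_point_ratio_odd[OF that(1) B(1)] B h(2)
      by (simp add: hyperbolic_psl fixed_point_ratio_psl)
    ultimately show ?thesis by simp
  qed
  show ?thesis
  proof (cases "even p")
    case True
    then show ?thesis
      using reciprocal_iff[OF assms(2), of "{0, 1, ereal (cos t)}"] fixed_point_ratio_even
      by (simp add: t_def)
  next
    case False
    then show ?thesis
      using reciprocal_iff[OF assms(2), of "{0}"] fixed_point_ratio_odd symmetric by simp
  qed
qed

end
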